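(* Let $N\geq1$, $g>0$, $\gamma_1,\dots,\gamma_N>0$ with $\sum_{i=1}^N\gamma_i=1$, $\boldsymbol{H}_N=(H_1,\dots,H_N)^T\in\mathbb{R}^N$ with $H_i>0$ for all $i$, and $\tilde{\boldsymbol{U}}_N=(\tilde u_1,\dots,\tilde u_N)^T\in\mathbb{R}^N$. Let $A_N$ be the $2N\times2N$ block matrix $$A_N=\begin{pmatrix}\mathrm{diag}(\tilde{\boldsymbol{U}}_N)&\mathrm{diag}(\boldsymbol{H}_N)\\ g\,\mathbf{1}_N\otimes\boldsymbol{\gamma}_N&\mathrm{diag}(\tilde{\boldsymbol{U}}_N)\end{pmatrix},$$ and set $\tilde u_-=\inf_\alpha\tilde u_\alpha$, $\tilde u_+=\sup_\alpha\tilde u_\alpha$, $h_N=\sum_{i=1}^N\gamma_iH_i$. If either 1. $\tilde u_+-\tilde u_-<\sqrt{gh_N}$, or 2. $\max_{i}\bigl(|\tilde u_i-\tilde u_{i+1}|^2\bigr)<8g\min_i(\gamma_iH_i)$, where the maximum is over $1\leq i\leq N-1$ and the minimum over $1\leq i\leq N$, then $$\sigma(A_N)\cap\mathbb{R}=\{c_-,c_+\}\cup\left\{c\in\tilde{\boldsymbol{U}}_N:\mathrm{card}\bigl(\tilde{\boldsymbol{U}}_N^{-1}(c)\bigr)>1\right\},$$ where $c_\pm$ are the eigenvalues of $A_N$ in $J_\pm$ (see context). In particular, if all the $\tilde u_i$ are distinct, this reduces to $\sigma(A_N)\cap\mathbb{R}=\{c_-,c_+\}$.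
   Context: $\mathbf{1}_N=(1,\dots,1)^T\in\mathbb{R}^N$, $\boldsymbol{\gamma}_N=(\gamma_1,\dots,\gamma_N)^T$, and $\mathbf{1}_N\otimes\boldsymbol{\gamma}_N$ is the $N\times N$ matrix with entries $(\mathbf{1}_N\otimes\boldsymbol{\gamma}_N)_{ij}=\gamma_j$. $\sigma(A_N)$ is the set of eigenvalues of $A_N$. $\tilde{\boldsymbol{U}}_N$ used as a set means $\{\tilde u_1,\dots,\tilde u_N\}$, and $\tilde{\boldsymbol{U}}_N^{-1}(c)=\{j\in\{1,\dots,N\}:\tilde u_j=c\}$. With $J_-=[\tilde u_--\sqrt{gh_N},\tilde u_-)$ and $J_+=(\tilde u_+,\tilde u_++\sqrt{gh_N}]$, $c_-$ is the unique eigenvalue of $A_N$ in $J_-$ and $c_+$ the unique eigenvalue of $A_N$ in $J_+$ (they exist and are unique whenever all $H_i>0$). *)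

theory Defs
  imports Complex_Main "Jordan_Normal_Form.Spectral_Radius"
begin

(* Vectors of length N are indexed by 0, ..., N - 1 instead of 1, ..., N. *)

definition ones_tensor :: "real vec \<Rightarrow> real mat" where
  "ones_tensor \<gamma> = mat (dim_vec \<gamma>) (dim_vec \<gamma>) (\<lambda>(i, j). \<gamma> $ j)"

definition diag_of :: "real vec \<Rightarrow> real mat" where
  "diag_of v = mat_diag (dim_vec v) (\<lambda>i. v $ i)"

definition A_mat :: "real \<Rightarrow> real vec \<Rightarrow> real vec \<Rightarrow> real vec \<Rightarrow> real mat" where
  "A_mat g \<gamma> H U =
     four_block_mat (diag_of U)                (diag_of H)
                    (g \<cdot>\<^sub>m ones_tensor \<gamma>)     (diag_of U)"

(* The spectrum is that of the real matrix regarded as a complex one, so that it contains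
   the non-real eigenvalues as well. *)
definition complex_spectrum :: "real mat \<Rightarrow> complex set" where
  "complex_spectrum A = spectrum (map_mat complex_of_real A)"

definition u_minus :: "real vec \<Rightarrow> real" where
  "u_minus U = (INF \<alpha>\<in>{..<dim_vec U}. U $ \<alpha>)"

definition u_plus :: "real vec \<Rightarrow> real" where
  "u_plus U = (SUP \<alpha>\<in>{..<dim_vec U}. U $ \<alpha>)"

definition h_total :: "real vec \<Rightarrow> real vec \<Rightarrow> real" where
  "h_total \<gamma> H = (\<Sum>i<dim_vec \<gamma>. \<gamma> $ i * H $ i)"

definition J_minus :: "real \<Rightarrow> real vec \<Rightarrow> real vec \<Rightarrow> real vec \<Rightarrow> real set" where
  "J_minus g \<gamma> H U = {u_minus U - sqrt (g * h_total \<gamma> H) ..< u_minus U}"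

definition J_plus :: "real \<Rightarrow> real vec \<Rightarrow> real vec \<Rightarrow> real vec \<Rightarrow> real set" where
  "J_plus g \<gamma> H U = {u_plus U <.. u_plus U + sqrt (g * h_total \<gamma> H)}"

(* The eigenvalue in each interval exists and is unique when g > 0, all entries of \<gamma> and H are
   positive and the entries of \<gamma> sum to 1; outside that situation THE may be meaningless. *)
definition c_minus :: "real \<Rightarrow> real vec \<Rightarrow> real vec \<Rightarrow> real vec \<Rightarrow> real" where
  "c_minus g \<gamma> H U =
     (THE c. c \<in> J_minus g \<gamma> H U \<and> complex_of_real c \<in> complex_spectrum (A_mat g \<gamma> H U))"

definition c_plus :: "real \<Rightarrow> real vec \<Rightarrow> real vec \<Rightarrow> real vec \<Rightarrow> real" where
  "c_plus g \<gamma> H U =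
     (THE c. c \<in> J_plus g \<gamma> H U \<and> complex_of_real c \<in> complex_spectrum (A_mat g \<gamma> H U))"

definition preimage_indices :: "real vec \<Rightarrow> real \<Rightarrow> nat set" where
  "preimage_indices U c = {j. j < dim_vec U \<and> U $ j = c}"

end

theory Submission
  imports Defs
begin

text \<open>Eliminating the second block of an eigenvector shows that a real number \<open>c\<close> different from
  every \<open>u\<^sub>i\<close> is an eigenvalue iff it solves the secular equation
  \<open>(\<Sum>i. g \<gamma>\<^sub>i H\<^sub>i / (c - u\<^sub>i)\<^sup>2) = 1\<close>, while \<open>c = u\<^sub>i\<close> is an eigenvalue iff that value is taken at least
  twice. To the right of all \<open>u\<^sub>i\<close> the left-hand side decreases strictly from infinity to zero, and
  symmetrically on the left, so each outer half-line carries exactly one root. Between the \<open>u\<^sub>i\<close> the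
  left-hand side exceeds 1: under the first condition because every denominator is smaller than
  \<open>g h\<close>; under the second because \<open>c\<close> is crossed by two consecutive velocities, whose two
  terms alone exceed 1, by the inequality \<open>1/x\<^sup>2 + 1/y\<^sup>2 \<ge> 8/(x+y)\<^sup>2\<close>.\<close>

section \<open>The secular function and its roots outside the range of the velocities\<close>

definition secular :: "nat \<Rightarrow> (nat \<Rightarrow> real) \<Rightarrow> (nat \<Rightarrow> real) \<Rightarrow> real \<Rightarrow> real" where
  "secular N a u c = (\<Sum>i<N. a i / (c - u i)\<^sup>2)"

lemma secular_reflect: "secular N a (\<lambda>i. - u i) (- c) = secular N a u c"
  unfolding secular_def by (intro sum.cong) (auto simp: power2_commute)

lemma secular_strict_antimono:
  assumes "N > 0" and "\<And>i. i < N \<Longrightarrow> a i > 0" and "\<And>i. i < N \<Longrightarrow> u i < x" and "x < y"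
  shows "secular N a u y < secular N a u x"
  unfolding secular_def
proof (rule sum_strict_mono)
  fix i assume "i \<in> {..<N}"
  then have i: "a i > 0" "u i < x" using assms by auto
  then have "(x - u i)\<^sup>2 < (y - u i)\<^sup>2" using \<open>x < y\<close> by (intro power_strict_mono) auto
  then show "a i / (y - u i)\<^sup>2 < a i / (x - u i)\<^sup>2"
    using i \<open>x < y\<close> by (intro divide_strict_left_mono) auto
qed (use assms in auto)

text \<open>The intermediate value theorem gives a root and strict decrease to the right of
  \<open>M\<close> excludes a second one. The explicit upper bound on the root is what later places
  it in \<open>J_plus\<close>.\<close>

lemma secular_root_right:
  assumes a: "\<And>i. i < N \<Longrightarrow> a i > 0" and le: "\<And>i. i < N \<Longrightarrow> u i \<le> M"
    and k: "k < N" "u k = M"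
  obtains c where "M < c" "c \<le> M + sqrt (\<Sum>i<N. a i)" "secular N a u c = 1"
    "\<And>x. M < x \<Longrightarrow> secular N a u x = 1 \<Longrightarrow> x = c"
proof -
  define S where "S = (\<Sum>i<N. a i)"
  have "a k > 0" using a k by auto
  have "a k \<le> S" unfolding S_def using a k by (intro member_le_sum) (auto intro: less_imp_le)
  then have "S > 0" using \<open>a k > 0\<close> by simp
  \<comment> \<open>At distance \<open>sqrt (a k)\<close> from \<open>u k = M\<close> the term of
    index \<open>k\<close> alone equals 1, so the sum is at least 1. At distance
    \<open>sqrt S\<close> every squared denominator is at least \<open>S\<close>, so the terms are
    bounded by \<open>a i / S\<close>, and these add up to 1.\<close>
  let ?l = "M + sqrt (a k)" and ?r = "M + sqrt S"
  have "M < ?l" "?l \<le> ?r" using \<open>a k > 0\<close> \<open>a k \<le> S\<close> by auto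
  have "x - u i \<noteq> 0" if "x \<in> {?l..?r}" "i < N" for x i
    using that le[of i] \<open>M < ?l\<close> by (simp, linarith)
  then have cont: "continuous_on {?l..?r} (secular N a u)"
    unfolding secular_def by (intro continuous_intros ballI) auto
  have "a k / (?l - u k)\<^sup>2 \<le> secular N a u ?l"
    unfolding secular_def using k by (intro member_le_sum) (auto simp: a less_imp_le)
  then have lower: "1 \<le> secular N a u ?l" using k \<open>a k > 0\<close> by simp
  have upper: "secular N a u ?r \<le> 1"
  proof -
    have "a i / (?r - u i)\<^sup>2 \<le> a i / S" if "i < N" for i
    proof (rule divide_left_mono)
      have "(sqrt S)\<^sup>2 \<le> (?r - u i)\<^sup>2" using le[OF that] \<open>S > 0\<close> by (intro power_mono) auto
      then show "S \<le> (?r - u i)\<^sup>2" using \<open>S > 0\<close> by simp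
      then show "0 < (?r - u i)\<^sup>2 * S" using \<open>S > 0\<close> by (intro mult_pos_pos) auto
    qed (use a that in \<open>auto intro: less_imp_le\<close>)
    then have "secular N a u ?r \<le> (\<Sum>i<N. a i / S)" unfolding secular_def by (intro sum_mono) auto
    also have "\<dots> = 1" using \<open>S > 0\<close> by (simp add: S_def flip: sum_divide_distrib)
    finally show ?thesis .
  qed
  obtain c where c: "?l \<le> c" "c \<le> ?r" "secular N a u c = 1"
    using IVT2'[OF upper lower \<open>?l \<le> ?r\<close> cont] by auto
  have uniq: "x = c" if x: "M < x" "secular N a u x = 1" for x
  proof (rule ccontr)
    assume "x \<noteq> c"
    then have "min x c < max x c" by auto
    moreover have "u i < min x c" if "i < N" for i using le[OF that] x(1) c(1) \<open>M < ?l\<close> by linarith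
    ultimately have "secular N a u (max x c) < secular N a u (min x c)"
      using a k by (intro secular_strict_antimono) auto
    then show False using x(2) c(3) by (auto simp: min_def max_def split: if_splits)
  qed
  have "M < c" using \<open>M < ?l\<close> c(1) by linarith
  then show thesis using c(2,3) uniq unfolding S_def by (rule that)
qed

text \<open>Reflecting both the velocities and \<open>c\<close> through 0 leaves
  \<open>secular\<close> unchanged and turns the left half-line into the right one.\<close>

lemma secular_root_left:
  assumes a: "\<And>i. i < N \<Longrightarrow> a i > 0" and ge: "\<And>i. i < N \<Longrightarrow> m \<le> u i"
    and k: "k < N" "u k = m"
  obtains c where "c < m" "m - sqrt (\<Sum>i<N. a i) \<le> c" "secular N a u c = 1"
    "\<And>x. x < m \<Longrightarrow> secular N a u x = 1 \<Longrightarrow> x = c"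
proof -
  obtain c where c: "- m < c" "c \<le> - m + sqrt (\<Sum>i<N. a i)" "secular N a (\<lambda>i. - u i) c = 1"
    "\<And>x. - m < x \<Longrightarrow> secular N a (\<lambda>i. - u i) x = 1 \<Longrightarrow> x = c"
  proof (rule secular_root_right[of N a "\<lambda>i. - u i" "- m" k])
    show "- u i \<le> - m" if "i < N" for i using ge[OF that] by simp
    show "- u k = - m" using k by simp
  qed (use a k in \<open>blast+\<close>)
  show thesis
  proof (rule that[of "- c"])
    show "secular N a u (- c) = 1" using c(3) secular_reflect[of N a u "- c"] by simp
    show "x = - c" if "x < m" "secular N a u x = 1" for x
      using c(4)[of "- x"] that by (simp add: secular_reflect)
  qed (use c(1,2) in auto)
qed

section \<open>Excluding roots between the velocities\<close>

lemma secular_gt_1_of_spread: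
  assumes "N > 0" and a: "\<And>i. i < N \<Longrightarrow> a i > 0"
    and near: "\<And>i. i < N \<Longrightarrow> \<bar>c - u i\<bar> < sqrt (\<Sum>i<N. a i)" and ne: "\<And>i. i < N \<Longrightarrow> c \<noteq> u i"
  shows "secular N a u c > 1"
proof -
  define S where "S = (\<Sum>i<N. a i)"
  have "S > 0" unfolding S_def using assms by (intro sum_pos) auto
  have "1 = (\<Sum>i<N. a i / S)" using \<open>S > 0\<close> by (simp add: S_def flip: sum_divide_distrib)
  also have "\<dots> < secular N a u c" unfolding secular_def
  proof (rule sum_strict_mono)
    fix i assume "i \<in> {..<N}"
    then have i: "i < N" by simp
    have "\<bar>c - u i\<bar>\<^sup>2 < (sqrt S)\<^sup>2" using near[OF i] unfolding S_def by (intro power_strict_mono) auto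
    then have "(c - u i)\<^sup>2 < S" using \<open>S > 0\<close> by simp
    then show "a i / S < a i / (c - u i)\<^sup>2"
      using a[OF i] ne[OF i] \<open>S > 0\<close> by (intro divide_strict_left_mono) auto
  qed (use assms in auto)
  finally show ?thesis .
qed

text \<open>A discrete intermediate value argument: if no consecutive pair straddled
  \<open>c\<close>, the truth value of \<open>u i < c\<close> would propagate from index 0 to all
  indices, against \<open>p\<close> and \<open>q\<close>. The velocities are not sorted, so the
  crossing may go up or down.\<close>

lemma exists_crossing:
  fixes u :: "nat \<Rightarrow> real"
  assumes "p < N" "q < N" "u p < c" "c < u q" and ne: "\<And>i. i < N \<Longrightarrow> c \<noteq> u i"
  shows "\<exists>i. i + 1 < N \<and> ((u i < c \<and> c < u (i + 1)) \<or> (u (i + 1) < c \<and> c < u i))"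
proof (rule ccontr)
  assume no: "\<not> ?thesis"
  have step: "u i < c \<longleftrightarrow> u (i + 1) < c" if "i + 1 < N" for i
    using no ne[of i] ne[of "i + 1"] that by (meson add_lessD1 linorder_neqE_linordered_idom)
  have "u i < c \<longleftrightarrow> u 0 < c" if "i < N" for i
    using that by (induction i) (use step in auto)
  then have "u p < c \<longleftrightarrow> u q < c" using assms(1,2) by blast
  then show False using assms(3,4) by simp
qed

text \<open>Both \<open>4 * x * y \<le> (x + y)^2\<close> and
  \<open>2 * x * y \<le> x^2 + y^2\<close> express that \<open>(x - y)^2\<close> is nonnegative.
  Since \<open>x * y\<close> is positive they can be multiplied, which is where the constant 8 comes
  from.\<close>

lemma inverse_squares_gt_1:
  fixes x y m :: real
  assumes "x \<noteq> 0" "y \<noteq> 0" "x * y > 0" and m: "(x + y)\<^sup>2 < 8 * m"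
  shows "m / x\<^sup>2 + m / y\<^sup>2 > 1"
proof -
  have "4 * (x * y) \<le> (x + y)\<^sup>2" "2 * (x * y) \<le> x\<^sup>2 + y\<^sup>2"
    using sum_squares_ge_zero[of "x - y" 0] by (auto simp: power2_eq_square algebra_simps)
  then have "(4 * (x * y)) * (2 * (x * y)) \<le> (x + y)\<^sup>2 * (x\<^sup>2 + y\<^sup>2)"
    using assms by (intro mult_mono) auto
  also have "\<dots> < (8 * m) * (x\<^sup>2 + y\<^sup>2)"
    using assms by (intro mult_strict_right_mono) (auto simp: sum_power2_gt_zero_iff)
  finally have "x\<^sup>2 * y\<^sup>2 < m * (x\<^sup>2 + y\<^sup>2)" by (simp add: power2_eq_square algebra_simps)
  then show ?thesis using assms by (simp add: field_simps)
qed

lemma secular_gt_1_of_crossing: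
  assumes a: "\<And>i. i < N \<Longrightarrow> a i > 0" and am: "\<And>i. i < N \<Longrightarrow> m \<le> a i"
    and gaps: "\<And>i. i + 1 < N \<Longrightarrow> (u i - u (i + 1))\<^sup>2 < 8 * m"
    and pq: "p < N" "q < N" "u p < c" "c < u q" and ne: "\<And>i. i < N \<Longrightarrow> c \<noteq> u i"
  shows "secular N a u c > 1"
proof -
  obtain i where i: "i + 1 < N" "(u i < c \<and> c < u (i + 1)) \<or> (u (i + 1) < c \<and> c < u i)"
    using exists_crossing[of p N q u c] pq ne by blast
  \<comment> \<open>The two signed distances from \<open>c\<close> have the same sign and add up to
    \<open>u (i + 1) - u i\<close>, so the gap bound applies whatever the position of
    \<open>c\<close> inside the gap.\<close>
  have "1 < m / (c - u i)\<^sup>2 + m / (u (i + 1) - c)\<^sup>2"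
  proof (rule inverse_squares_gt_1)
    show "(c - u i) * (u (i + 1) - c) > 0" using i(2) by (auto simp: zero_less_mult_iff)
    show "(c - u i + (u (i + 1) - c))\<^sup>2 < 8 * m"
      using gaps[OF i(1)] by (simp add: power2_commute)
  qed (use i in auto)
  also have "\<dots> \<le> a i / (c - u i)\<^sup>2 + a (i + 1) / (c - u (i + 1))\<^sup>2"
    using am[of i] am[of "i + 1"] i(1)
    by (auto intro!: add_mono divide_right_mono simp: power2_commute[of c "u (Suc i)"])
  also have "\<dots> = (\<Sum>j\<in>{i, i + 1}. a j / (c - u j)\<^sup>2)" by simp
  also have "\<dots> \<le> secular N a u c" unfolding secular_def
    using i(1) by (intro sum_mono2) (auto simp: a less_imp_le)
  finally show ?thesis .
qed

section \<open>Real eigenvalues of the block matrix\<close>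

lemma of_real_in_complex_spectrum_iff:
  assumes "A \<in> carrier_mat n n"
  shows "complex_of_real c \<in> complex_spectrum A \<longleftrightarrow> eigenvalue A c"
proof -
  have "map_mat complex_of_real A \<in> carrier_mat n n" using assms by simp
  \<comment> \<open>Both sides become root conditions, and the characteristic polynomial of the
    complexified matrix is the image of the real one. Real spectral points can therefore be studied
    with real eigenvectors.\<close>
  then show ?thesis
    unfolding complex_spectrum_def
    by (simp add: spectrum_root_char_poly eigenvalue_root_char_poly[OF assms]
        of_real_hom.char_poly_hom[OF assms])
qed

lemma A_mat_carrier:
  assumes "\<gamma> \<in> carrier_vec N" "H \<in> carrier_vec N" "U \<in> carrier_vec N"
  shows "A_mat g \<gamma> H U \<in> carrier_mat (N + N) (N + N)"
  using assms unfolding A_mat_def diag_of_def ones_tensor_def by auto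

lemma diag_of_mult_vec:
  assumes "d \<in> carrier_vec N" "v \<in> carrier_vec N"
  shows "diag_of d *\<^sub>v v = vec N (\<lambda>i. d $ i * v $ i)"
  using assms by (intro eq_vecI)
    (auto simp: diag_of_def mat_diag_def scalar_prod_def if_distrib[of "\<lambda>x. x * _"] cong: if_cong)

lemma ones_tensor_mult_vec:
  assumes "\<gamma> \<in> carrier_vec N" "v \<in> carrier_vec N"
  shows "(g \<cdot>\<^sub>m ones_tensor \<gamma>) *\<^sub>v v = vec N (\<lambda>i. g * (\<Sum>j<N. \<gamma> $ j * v $ j))"
  using assms by (intro eq_vecI)
    (auto simp: ones_tensor_def scalar_prod_def sum_distrib_left atLeast0LessThan mult.assoc)

text \<open>All rows of \<open>ones_tensor \<gamma>\<close> agree, so the lower block couples the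
  indices only through one scalar, the weighted sum of \<open>v\<close>. Both eigenvalue criteria
  below rest on eliminating everything but this scalar.\<close>

lemma A_mat_eigen_eqs:
  assumes "\<gamma> \<in> carrier_vec N" "H \<in> carrier_vec N" "U \<in> carrier_vec N"
    and "v \<in> carrier_vec N" "w \<in> carrier_vec N"
  shows "A_mat g \<gamma> H U *\<^sub>v (v @\<^sub>v w) = c \<cdot>\<^sub>v (v @\<^sub>v w) \<longleftrightarrow>
    (\<forall>i<N. (c - U $ i) * v $ i = H $ i * w $ i \<and>
           (c - U $ i) * w $ i = g * (\<Sum>j<N. \<gamma> $ j * v $ j))"
proof -
  have "A_mat g \<gamma> H U *\<^sub>v (v @\<^sub>v w) = (diag_of U *\<^sub>v v + diag_of H *\<^sub>v w) @\<^sub>v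
      ((g \<cdot>\<^sub>m ones_tensor \<gamma>) *\<^sub>v v + diag_of U *\<^sub>v w)"
    unfolding A_mat_def using assms
    by (intro four_block_mat_mult_vec[of _ N N _ N _ N])
      (auto simp: diag_of_def ones_tensor_def)
  also have "\<dots> = vec N (\<lambda>i. U $ i * v $ i + H $ i * w $ i) @\<^sub>v
      vec N (\<lambda>i. g * (\<Sum>j<N. \<gamma> $ j * v $ j) + U $ i * w $ i)"
    using assms by (auto simp: diag_of_mult_vec[where N=N] ones_tensor_mult_vec[where N=N]
        intro!: arg_cong2[of _ _ _ _ append_vec])
  finally have lhs: "A_mat g \<gamma> H U *\<^sub>v (v @\<^sub>v w) = \<dots>" .
  have rhs: "c \<cdot>\<^sub>v (v @\<^sub>v w) = vec N (\<lambda>i. c * v $ i) @\<^sub>v vec N (\<lambda>i. c * w $ i)"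
    using assms by (intro eq_vecI) auto
  show ?thesis unfolding lhs rhs
    by (subst append_vec_eq[of _ N]) (auto simp: vec_eq_iff algebra_simps)
qed

lemma eigenvalue_A_mat_iff:
  assumes "\<gamma> \<in> carrier_vec N" "H \<in> carrier_vec N" "U \<in> carrier_vec N"
  shows "eigenvalue (A_mat g \<gamma> H U) c \<longleftrightarrow>
    (\<exists>v w. v \<in> carrier_vec N \<and> w \<in> carrier_vec N \<and> (v \<noteq> 0\<^sub>v N \<or> w \<noteq> 0\<^sub>v N) \<and>
      (\<forall>i<N. (c - U $ i) * v $ i = H $ i * w $ i \<and>
             (c - U $ i) * w $ i = g * (\<Sum>j<N. \<gamma> $ j * v $ j)))"
    (is "_ \<longleftrightarrow> (\<exists>v w. ?P v w)")
proof -
  have dim: "dim_row (A_mat g \<gamma> H U) = N + N" using A_mat_carrier[OF assms] by auto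
  have nz: "v @\<^sub>v w = 0\<^sub>v (N + N) \<longleftrightarrow> v = 0\<^sub>v N \<and> w = 0\<^sub>v N"
    if "v \<in> carrier_vec N" for v w :: "real vec"
  proof -
    have "0\<^sub>v (N + N) = (0\<^sub>v N @\<^sub>v 0\<^sub>v N :: real vec)" by (intro eq_vecI) auto
    then show ?thesis using append_vec_eq[OF that, of "0\<^sub>v N" w "0\<^sub>v N"] by simp
  qed
  \<comment> \<open>The double negation brings the existence of an eigenvector into the universal
    form that \<open>all_vec_append\<close> splits into two halves.\<close>
  have "eigenvalue (A_mat g \<gamma> H U) c \<longleftrightarrow> \<not> (\<forall>x\<in>carrier_vec (N + N).
      \<not> (x \<noteq> 0\<^sub>v (N + N) \<and> A_mat g \<gamma> H U *\<^sub>v x = c \<cdot>\<^sub>v x))"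
    unfolding eigenvalue_def eigenvector_def dim by auto
  also have "\<dots> \<longleftrightarrow> (\<exists>v\<in>carrier_vec N. \<exists>w\<in>carrier_vec N.
      v @\<^sub>v w \<noteq> 0\<^sub>v (N + N) \<and> A_mat g \<gamma> H U *\<^sub>v (v @\<^sub>v w) = c \<cdot>\<^sub>v (v @\<^sub>v w))"
    unfolding all_vec_append by blast
  also have "\<dots> \<longleftrightarrow> (\<exists>v w. ?P v w)"
    unfolding Bex_def by (intro ex_cong1) (auto simp: nz A_mat_eigen_eqs[OF assms])
  finally show ?thesis .
qed

text \<open>Off the velocities, the scalar \<open>S\<close> determines \<open>w\<close> and then
  \<open>v\<close>. Inserting this \<open>v\<close> into the definition of \<open>S\<close> gives
  \<open>S = S * secular\<close>, and \<open>S = 0\<close> would make the whole eigenvector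
  vanish.\<close>

lemma eigenvalue_A_mat_iff_secular:
  assumes "g \<noteq> 0" and car: "\<gamma> \<in> carrier_vec N" "H \<in> carrier_vec N" "U \<in> carrier_vec N"
    and ne: "\<And>i. i < N \<Longrightarrow> c \<noteq> U $ i"
  shows "eigenvalue (A_mat g \<gamma> H U) c \<longleftrightarrow> secular N (\<lambda>i. g * (\<gamma> $ i * H $ i)) (($) U) c = 1"
proof
  assume "eigenvalue (A_mat g \<gamma> H U) c"
  then obtain v w where vw: "v \<in> carrier_vec N" "w \<in> carrier_vec N" "v \<noteq> 0\<^sub>v N \<or> w \<noteq> 0\<^sub>v N"
    "\<And>i. i < N \<Longrightarrow> (c - U $ i) * v $ i = H $ i * w $ i"
    "\<And>i. i < N \<Longrightarrow> (c - U $ i) * w $ i = g * (\<Sum>j<N. \<gamma> $ j * v $ j)"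
    unfolding eigenvalue_A_mat_iff[OF car] by blast
  define S where "S = (\<Sum>j<N. \<gamma> $ j * v $ j)"
  have w: "w $ i = g * S / (c - U $ i)" if "i < N" for i
    using vw(5)[OF that] ne[OF that] by (simp add: S_def field_simps)
  have v: "v $ i = H $ i * (g * S) / (c - U $ i)\<^sup>2" if "i < N" for i
  proof -
    have "v $ i = H $ i * w $ i / (c - U $ i)"
      using vw(4)[OF that] ne[OF that] by (simp add: eq_divide_eq mult.commute)
    then show ?thesis by (simp add: w[OF that] power2_eq_square)
  qed
  have "S \<noteq> 0"
  proof
    assume "S = 0"
    then have "v = 0\<^sub>v N" "w = 0\<^sub>v N" using vw(1,2) v w by auto
    then show False using vw(3) by simp
  qed
  have "S = S * secular N (\<lambda>i. g * (\<gamma> $ i * H $ i)) (($) U) c"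
    unfolding secular_def sum_distrib_left
    by (subst S_def, rule sum.cong) (auto simp: v)
  then show "secular N (\<lambda>i. g * (\<gamma> $ i * H $ i)) (($) U) c = 1" using \<open>S \<noteq> 0\<close> by simp
next
  assume sec: "secular N (\<lambda>i. g * (\<gamma> $ i * H $ i)) (($) U) c = 1"
  \<comment> \<open>This is the eigenvector produced by the elimination, normalised so that
    \<open>S = 1\<close>.\<close>
  define v where "v = vec N (\<lambda>i. H $ i * g / (c - U $ i)\<^sup>2)"
  define w where "w = vec N (\<lambda>i. g / (c - U $ i))"
  have S: "(\<Sum>j<N. \<gamma> $ j * v $ j) = 1"
    using sec unfolding secular_def by (simp add: v_def ac_simps)
  have "N > 0" using sec by (cases N) (auto simp: secular_def)
  then have "w $ 0 \<noteq> 0" using \<open>g \<noteq> 0\<close> ne[of 0] by (simp add: w_def)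
  then have "w \<noteq> 0\<^sub>v N" using \<open>N > 0\<close> by auto
  moreover have "(c - U $ i) * v $ i = H $ i * w $ i \<and> (c - U $ i) * w $ i = g" if "i < N" for i
    using ne[OF that] that by (simp add: v_def w_def power2_eq_square)
  ultimately show "eigenvalue (A_mat g \<gamma> H U) c"
    unfolding eigenvalue_A_mat_iff[OF car]
    by (intro exI[of _ v] exI[of _ w]) (simp add: S, auto simp: v_def w_def)
qed

text \<open>At a velocity the equation for \<open>w $ k\<close> forces the weighted sum of
  \<open>v\<close> to be 0. Then \<open>w\<close> vanishes and \<open>v\<close> lives on the indices
  with velocity \<open>c\<close>; one linear condition on \<open>v\<close> leaves a nonzero solution
  exactly when there are at least two such indices.\<close>

lemma eigenvalue_A_mat_at_entry_iff:
  assumes "g \<noteq> 0" and car: "\<gamma> \<in> carrier_vec N" "H \<in> carrier_vec N" "U \<in> carrier_vec N"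
    and \<gamma>: "\<And>i. i < N \<Longrightarrow> \<gamma> $ i \<noteq> 0" and H: "\<And>i. i < N \<Longrightarrow> H $ i \<noteq> 0"
    and k: "k < N" "U $ k = c"
  shows "eigenvalue (A_mat g \<gamma> H U) c \<longleftrightarrow> card (preimage_indices U c) > 1"
proof
  have fin: "finite (preimage_indices U c)" by (simp add: preimage_indices_def)
  have kin: "k \<in> preimage_indices U c" using k car by (simp add: preimage_indices_def)
  {
    assume "eigenvalue (A_mat g \<gamma> H U) c"
    then obtain v w where vw: "v \<in> carrier_vec N" "w \<in> carrier_vec N" "v \<noteq> 0\<^sub>v N \<or> w \<noteq> 0\<^sub>v N"
      "\<And>i. i < N \<Longrightarrow> (c - U $ i) * v $ i = H $ i * w $ i"
      "\<And>i. i < N \<Longrightarrow> (c - U $ i) * w $ i = g * (\<Sum>j<N. \<gamma> $ j * v $ j)"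
      unfolding eigenvalue_A_mat_iff[OF car] by blast
    have S: "(\<Sum>j<N. \<gamma> $ j * v $ j) = 0" using vw(5)[OF k(1)] k \<open>g \<noteq> 0\<close> by simp
    \<comment> \<open>If \<open>c\<close> differs from \<open>U $ i\<close>, the second equation
      gives this; otherwise the first one does, because \<open>H $ i\<close> is nonzero.\<close>
    have w: "w $ i = 0" if "i < N" for i
      using vw(4,5)[OF that] S H[OF that] by (cases "c = U $ i") auto
    have v: "v $ i = 0" if "i < N" "U $ i \<noteq> c" for i
      using vw(4)[OF that(1)] w[OF that(1)] that by auto
    have "w = 0\<^sub>v N" using vw(2) w by auto
    show "card (preimage_indices U c) > 1"
    proof (rule ccontr)
      assume "\<not> card (preimage_indices U c) > 1"
      then have single: "j = k" if "j < N" "U $ j = c" for j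
      proof -
        have "j \<in> preimage_indices U c" using that car by (auto simp: preimage_indices_def)
        then show ?thesis
          using \<open>\<not> card (preimage_indices U c) > 1\<close> card_le_Suc0_iff_eq[OF fin] kin
          by (metis One_nat_def not_less)
      qed
      then have v': "v $ j = 0" if "j < N" "j \<noteq> k" for j using v that by blast
      have "(\<Sum>j<N. \<gamma> $ j * v $ j) = (\<Sum>j\<in>{k}. \<gamma> $ j * v $ j)"
        using k by (intro sum.mono_neutral_right) (auto simp: v')
      then have "v $ k = 0" using S \<gamma>[OF k(1)] by simp
      then have "v $ i = 0" if "i < N" for i using v'[OF that] by (cases "i = k") auto
      then have "v = 0\<^sub>v N" using vw(1) by auto
      then show False using vw(3) \<open>w = 0\<^sub>v N\<close> by simp
    qed
  }
  assume "card (preimage_indices U c) > 1"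
  then obtain l where l: "l < N" "U $ l = c" "l \<noteq> k"
  proof -
    have "\<not> card (preimage_indices U c) \<le> Suc 0" using \<open>card (preimage_indices U c) > 1\<close> by simp
    then obtain x y where "x \<in> preimage_indices U c" "y \<in> preimage_indices U c" "x \<noteq> y"
      using card_le_Suc0_iff_eq[OF fin] by blast
    then show thesis using that[of x] that[of y] car by (auto simp: preimage_indices_def)
  qed
  \<comment> \<open>Swapping the two weights and changing one sign makes the weighted sum cancel;
    the second half of the eigenvector is 0.\<close>
  define v where "v = vec N (\<lambda>i. if i = k then \<gamma> $ l else if i = l then - \<gamma> $ k else 0)"
  have "(\<Sum>j<N. \<gamma> $ j * v $ j) = (\<Sum>j\<in>{k, l}. \<gamma> $ j * v $ j)"
    using k l by (intro sum.mono_neutral_right) (auto simp: v_def)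
  also have "\<dots> = 0" using k l by (simp add: v_def)
  finally have S: "(\<Sum>j<N. \<gamma> $ j * v $ j) = 0" .
  have "v $ k \<noteq> 0" using k \<gamma>[OF l(1)] by (simp add: v_def)
  then have "v \<noteq> 0\<^sub>v N" using k by auto
  then show "eigenvalue (A_mat g \<gamma> H U) c"
    unfolding eigenvalue_A_mat_iff[OF car]
    using k l S by (intro exI[of _ v] exI[of _ "0\<^sub>v N"]) (auto simp: v_def)
qed

section \<open>Locating all real eigenvalues\<close>

theorem proposition5p8:
  fixes N :: nat and g :: real and \<gamma> H U :: "real vec"
  assumes "N \<ge> 1" and "g > 0"
    and "\<gamma> \<in> carrier_vec N" and "H \<in> carrier_vec N" and "U \<in> carrier_vec N"
    and "\<And>i. i < N \<Longrightarrow> \<gamma> $ i > 0" and "(\<Sum>i<N. \<gamma> $ i) = 1"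
    and "\<And>i. i < N \<Longrightarrow> H $ i > 0"
    and "u_plus U - u_minus U < sqrt (g * h_total \<gamma> H)
       \<or> Max ((\<lambda>i. \<bar>U $ i - U $ (i + 1)\<bar>\<^sup>2) ` {..<N - 1})
           < 8 * g * Min ((\<lambda>i. \<gamma> $ i * H $ i) ` {..<N})"
  shows "complex_spectrum (A_mat g \<gamma> H U) \<inter> \<real> =
           complex_of_real ` ({c_minus g \<gamma> H U, c_plus g \<gamma> H U}
             \<union> {c \<in> set\<^sub>v U. card (preimage_indices U c) > 1})
       \<and> (inj_on (\<lambda>i. U $ i) {..<N} \<longrightarrow>
           complex_spectrum (A_mat g \<gamma> H U) \<inter> \<real> =
             complex_of_real ` {c_minus g \<gamma> H U, c_plus g \<gamma> H U})"
proof -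
  note car = assms(3,4,5)
  define a where "a i = g * (\<gamma> $ i * H $ i)" for i
  define E where "E = {c. eigenvalue (A_mat g \<gamma> H U) c}"
  define D where "D = {c \<in> set\<^sub>v U. card (preimage_indices U c) > 1}"
  have dim: "dim_vec U = N" "dim_vec \<gamma> = N" using car by auto
  have N: "N > 0" using assms(1) by simp
  have a: "a i > 0" if "i < N" for i using assms(2,6,8) that by (simp add: a_def)
  \<comment> \<open>This identifies the root bounds of the secular lemmas with the length of
    \<open>J_minus\<close> and \<open>J_plus\<close>.\<close>
  have sum_a: "(\<Sum>i<N. a i) = g * h_total \<gamma> H"
    by (simp add: a_def h_total_def dim sum_distrib_left)
  have spec: "complex_of_real c \<in> complex_spectrum (A_mat g \<gamma> H U) \<longleftrightarrow> c \<in> E" for c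
    using of_real_in_complex_spectrum_iff[OF A_mat_carrier[OF car]] by (simp add: E_def)
  have real_spec: "complex_spectrum (A_mat g \<gamma> H U) \<inter> \<real> = complex_of_real ` E"
    using spec by (auto simp: Reals_def)
  have um: "u_minus U = Min (($) U ` {..<N})" and up: "u_plus U = Max (($) U ` {..<N})"
    using N unfolding u_minus_def u_plus_def dim by (auto intro!: cInf_eq_Min cSup_eq_Max)
  have fin: "finite (($) U ` {..<N})" "($) U ` {..<N} \<noteq> {}" using N by auto
  obtain p where p: "p < N" "U $ p = u_minus U" using Min_in[OF fin] by (auto simp: um)
  obtain q where q: "q < N" "U $ q = u_plus U" using Max_in[OF fin] by (auto simp: up)
  have ge: "u_minus U \<le> U $ i" and le: "U $ i \<le> u_plus U" if "i < N" for i
    using that by (auto simp: um up)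
  obtain cm where cm: "cm < u_minus U" "u_minus U - sqrt (\<Sum>i<N. a i) \<le> cm"
      "secular N a (($) U) cm = 1"
      "\<And>x. x < u_minus U \<Longrightarrow> secular N a (($) U) x = 1 \<Longrightarrow> x = cm"
    using secular_root_left[of N a "u_minus U" "($) U" p] a ge p by metis
  obtain cp where cp: "u_plus U < cp" "cp \<le> u_plus U + sqrt (\<Sum>i<N. a i)"
      "secular N a (($) U) cp = 1"
      "\<And>x. u_plus U < x \<Longrightarrow> secular N a (($) U) x = 1 \<Longrightarrow> x = cp"
    using secular_root_right[of N a "($) U" "u_plus U" q] a le q by metis
  have E_sec: "c \<in> E \<longleftrightarrow> secular N a (($) U) c = 1" if "\<And>i. i < N \<Longrightarrow> c \<noteq> U $ i" for c
    using eigenvalue_A_mat_iff_secular[of g \<gamma> N H U c] assms(2) car that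
    by (simp add: E_def a_def[abs_def])
  have E_entry: "c \<in> E \<longleftrightarrow> c \<in> D" if "k < N" "U $ k = c" for c k
  proof -
    have "c \<in> set\<^sub>v U" using that by (auto simp: vec_set_def dim)
    then show ?thesis
      using eigenvalue_A_mat_at_entry_iff[of g \<gamma> N H U k c] assms(2) car that
        assms(6,8)[THEN less_imp_neq[THEN not_sym]]
      unfolding E_def D_def by simp
  qed
  have E_left: "c \<in> E \<longleftrightarrow> c = cm" if "c < u_minus U" for c
  proof -
    have "c \<noteq> U $ i" if "i < N" for i using ge[OF that] \<open>c < u_minus U\<close> by simp
    then show ?thesis using E_sec[of c] that cm(3,4) by blast
  qed
  have E_right: "c \<in> E \<longleftrightarrow> c = cp" if "u_plus U < c" for c
  proof -
    have "c \<noteq> U $ i" if "i < N" for i using le[OF that] \<open>u_plus U < c\<close> by auto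
    then show ?thesis using E_sec[of c] that cp(3,4) by blast
  qed
  have interior: "secular N a (($) U) c > 1"
    if c: "u_minus U \<le> c" "c \<le> u_plus U" and ne: "\<And>i. i < N \<Longrightarrow> c \<noteq> U $ i" for c
    using assms(9)
  proof
    assume "u_plus U - u_minus U < sqrt (g * h_total \<gamma> H)"
    \<comment> \<open>Both \<open>c\<close> and \<open>U $ i\<close> lie between the extreme
      velocities, so their distance is at most the spread.\<close>
    then have near: "\<bar>c - U $ i\<bar> < sqrt (\<Sum>i<N. a i)" if "i < N" for i
      using c ge[OF that] le[OF that] unfolding sum_a by linarith
    show ?thesis by (rule secular_gt_1_of_spread[OF N a near ne])
  next
    assume gap: "Max ((\<lambda>i. \<bar>U $ i - U $ (i + 1)\<bar>\<^sup>2) ` {..<N - 1})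
        < 8 * g * Min ((\<lambda>i. \<gamma> $ i * H $ i) ` {..<N})"
    define m where "m = g * Min ((\<lambda>i. \<gamma> $ i * H $ i) ` {..<N})"
    show ?thesis
    proof (rule secular_gt_1_of_crossing)
      show "m \<le> a i" if "i < N" for i
        using that assms(2) unfolding m_def a_def by (intro mult_left_mono) auto
      \<comment> \<open>For \<open>N = 1\<close> the maximum is taken over the empty set and has no
        meaningful value, but then there is no such \<open>i\<close>.\<close>
      show "(U $ i - U $ (i + 1))\<^sup>2 < 8 * m" if "i + 1 < N" for i
      proof -
        have "\<bar>U $ i - U $ (i + 1)\<bar>\<^sup>2 \<le> Max ((\<lambda>i. \<bar>U $ i - U $ (i + 1)\<bar>\<^sup>2) ` {..<N - 1})"
          using that by (intro Max_ge) auto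
        then show ?thesis using gap by (simp add: m_def)
      qed
      show "U $ p < c" "c < U $ q" using c p q ne[of p] ne[of q] by auto
    qed (use a p q ne in auto)
  qed
  have E_between: "c \<in> E \<longleftrightarrow> c \<in> D" if "u_minus U \<le> c" "c \<le> u_plus U" for c
  proof (cases "\<exists>k<N. U $ k = c")
    case True
    then show ?thesis using E_entry by blast
  next
    case False
    then have "c \<notin> E" using E_sec[of c] interior[of c] that by force
    moreover have "c \<notin> D" using False by (auto simp: D_def vec_set_def dim)
    ultimately show ?thesis by simp
  qed
  have D_between: "u_minus U \<le> c \<and> c \<le> u_plus U" if "c \<in> D" for c
    using that ge le by (auto simp: D_def vec_set_def dim)
  \<comment> \<open>Every real number lies left of, right of, or within the closed range of
    velocities. \<open>D_between\<close> keeps \<open>D\<close> out of the two outer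
    half-lines.\<close>
  have E: "E = {cm, cp} \<union> D"
    using E_left E_right E_between D_between cm(1) cp(1) by (auto, (meson not_le)+)
  \<comment> \<open>\<open>J_minus\<close> lies inside the left half-line, where \<open>cm\<close>
    is the only eigenvalue, so the description by \<open>THE\<close> is meaningful; likewise for
    \<open>J_plus\<close> and \<open>cp\<close>.\<close>
  have "c_minus g \<gamma> H U = cm"
    unfolding c_minus_def J_minus_def spec
    using E_left cm(1,2) by (intro the_equality) (auto simp: sum_a)
  moreover have "c_plus g \<gamma> H U = cp"
    unfolding c_plus_def J_plus_def spec
    using E_right cp(1,2) by (intro the_equality) (auto simp: sum_a)
  moreover have "D = {}" if "inj_on (\<lambda>i. U $ i) {..<N}"
  proof -
    have "card (preimage_indices U c) \<le> Suc 0" for c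
      using that by (subst card_le_Suc0_iff_eq) (auto simp: preimage_indices_def dim inj_on_def)
    then show ?thesis by (auto simp: D_def simp flip: not_le)
  qed
  ultimately show ?thesis using real_spec E by (auto simp: D_def)
qed

end
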